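(* Let $A$ be an integral domain, let $E$ be a nonzero $A$-module, let $R=A\propto E$ and let $n$ be a positive integer. The following statements are equivalent. (1) $R$ is an $n$-OAF-ring. (2) $A$ is a field. (3) Every proper ideal of $R$ is an $n$-OA ideal.
   Context: All rings are commutative with $1\neq 0$. The trivial extension $A\propto E$ is the additive group $A\oplus E$ with multiplication $(a,e)(b,f)=(ab,af+be)$. A proper ideal $I$ of a ring $R$ is an $n$-OA ideal if whenever $a_1a_2\cdots a_{n+1}\in I$ for nonunits $a_1,\ldots,a_{n+1}\in R$, then $a_1a_2\cdots a_n\in I$ or $a_{n+1}\in I$. A ring $R$ is an $n$-OAF-ring if every proper ideal of $R$ is a product of finitely many $n$-OA ideals of $R$.
   Formalization: The equivalence is proved for n ≥ 2; for n = 1 only (1)⇒(2) and (3)⇒(1) are, since if n = 1 and A is a field, (2) holds but (3) fails: 1-OA ideals are prime, and the zero ideal of R is not prime because (0,e)(0,e) = 0 for nonzero e in E. *)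

theory Defs
  imports "HOL-Algebra.Ideal_Product" "HOL-Algebra.Module"
begin

definition trivial_ext ::
  "('a, 'm) ring_scheme \<Rightarrow> ('a, 'e, 'k) module_scheme \<Rightarrow> ('a \<times> 'e) ring" (infixl \<open>\<propto>\<close> 65)
  where "A \<propto> E =
    \<lparr> carrier = carrier A \<times> carrier E,
      mult = (\<lambda>(a, e) (b, f). (a \<otimes>\<^bsub>A\<^esub> b, (a \<odot>\<^bsub>E\<^esub> f) \<oplus>\<^bsub>E\<^esub> (b \<odot>\<^bsub>E\<^esub> e))),
      one = (\<one>\<^bsub>A\<^esub>, \<zero>\<^bsub>E\<^esub>),
      zero = (\<zero>\<^bsub>A\<^esub>, \<zero>\<^bsub>E\<^esub>),
      add = (\<lambda>(a, e) (b, f). (a \<oplus>\<^bsub>A\<^esub> b, e \<oplus>\<^bsub>E\<^esub> f)) \<rparr>"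

definition proper_ideal :: "'a set \<Rightarrow> ('a, 'm) ring_scheme \<Rightarrow> bool"
  where "proper_ideal I R \<longleftrightarrow> ideal I R \<and> I \<noteq> carrier R"

definition n_OA_ideal :: "nat \<Rightarrow> 'a set \<Rightarrow> ('a, 'm) ring_scheme \<Rightarrow> bool"
  where "n_OA_ideal n I R \<longleftrightarrow>
    proper_ideal I R \<and>
    (\<forall>a \<in> {1..n + 1} \<rightarrow> carrier R - Units R.
       finprod R a {1..n + 1} \<in> I \<longrightarrow> finprod R a {1..n} \<in> I \<or> a (n + 1) \<in> I)"

text \<open>The empty product of ideals is the whole ring, so for proper ideals it makes no difference
  that the list of factors below may be empty.\<close>

definition ideal_product :: "('a, 'm) ring_scheme \<Rightarrow> 'a set list \<Rightarrow> 'a set"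
  where "ideal_product R Is = foldr (ideal_prod R) Is (carrier R)"

definition n_OAF_ring :: "nat \<Rightarrow> ('a, 'm) ring_scheme \<Rightarrow> bool"
  where "n_OAF_ring n R \<longleftrightarrow>
    (\<forall>I. proper_ideal I R \<longrightarrow>
       (\<exists>Is. (\<forall>J \<in> set Is. n_OA_ideal n J R) \<and> I = ideal_product R Is))"

lemma trivial_ext_simps [simp]:
  "carrier (A \<propto> E) = carrier A \<times> carrier E"
  "(a, e) \<otimes>\<^bsub>A \<propto> E\<^esub> (b, f) = (a \<otimes>\<^bsub>A\<^esub> b, (a \<odot>\<^bsub>E\<^esub> f) \<oplus>\<^bsub>E\<^esub> (b \<odot>\<^bsub>E\<^esub> e))"
  "\<one>\<^bsub>A \<propto> E\<^esub> = (\<one>\<^bsub>A\<^esub>, \<zero>\<^bsub>E\<^esub>)"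
  "\<zero>\<^bsub>A \<propto> E\<^esub> = (\<zero>\<^bsub>A\<^esub>, \<zero>\<^bsub>E\<^esub>)"
  "(a, e) \<oplus>\<^bsub>A \<propto> E\<^esub> (b, f) = (a \<oplus>\<^bsub>A\<^esub> b, e \<oplus>\<^bsub>E\<^esub> f)"
  by (simp_all add: trivial_ext_def)

lemma cring_trivial_ext:
  assumes "module A E"
  shows "cring (A \<propto> E)"
proof -
  interpret module A E by fact
  show ?thesis
  proof (rule cringI)
    show "abelian_group (A \<propto> E)"
    proof (rule abelian_groupI)
      fix x assume "x \<in> carrier (A \<propto> E)"
      then obtain a e where x: "x = (a, e)" "a \<in> carrier A" "e \<in> carrier E" by auto
      show "\<exists>y\<in>carrier (A \<propto> E). y \<oplus>\<^bsub>A \<propto> E\<^esub> x = \<zero>\<^bsub>A \<propto> E\<^esub>"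
        by (rule bexI[of _ "(\<ominus>\<^bsub>A\<^esub> a, \<ominus>\<^bsub>E\<^esub> e)"])
          (use x in \<open>simp_all add: R.l_neg M.l_neg\<close>)
    qed (auto simp: R.a_ac M.a_ac)
    show "comm_monoid (A \<propto> E)"
      by (rule comm_monoidI)
        (auto simp: R.m_ac smult_assoc1[symmetric] smult_r_distr M.a_ac
          smult_l_null smult_r_null)
  qed (auto simp: R.l_distr smult_l_distr smult_r_distr M.a_ac)
qed

text \<open>A 1-OA ideal is a prime ideal. The zero ideal of a trivial extension by a nonzero module is
  never prime, so for n = 1 some proper ideal is not n-OA, even over a field.\<close>

lemma zero_ideal_not_1_OA:
  assumes "domain A" and "module A E" and "carrier E \<noteq> {\<zero>\<^bsub>E\<^esub>}"
  shows "proper_ideal {\<zero>\<^bsub>A \<propto> E\<^esub>} (A \<propto> E)" and "\<not> n_OA_ideal 1 {\<zero>\<^bsub>A \<propto> E\<^esub>} (A \<propto> E)"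
proof -
  interpret A: domain A by fact
  interpret E: module A E by fact
  interpret R: cring "A \<propto> E" by (rule cring_trivial_ext) fact
  obtain e where e: "e \<in> carrier E" "e \<noteq> \<zero>\<^bsub>E\<^esub>"
    using assms(3) E.M.zero_closed by blast
  define x where "x = (\<zero>\<^bsub>A\<^esub>, e)"
  have x: "x \<in> carrier (A \<propto> E)" "x \<noteq> \<zero>\<^bsub>A \<propto> E\<^esub>"
    using e by (auto simp: x_def)
  have xx: "x \<otimes>\<^bsub>A \<propto> E\<^esub> x = \<zero>\<^bsub>A \<propto> E\<^esub>"
    using e by (simp add: x_def E.smult_l_null)
  have nonunit: "x \<notin> Units (A \<propto> E)"
    using x xx by (metis R.Units_l_cancel R.r_null R.zero_closed)
  show "proper_ideal {\<zero>\<^bsub>A \<propto> E\<^esub>} (A \<propto> E)"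
    unfolding proper_ideal_def using R.zeroideal x by blast
  have "finprod (A \<propto> E) (\<lambda>_. x) {1..1 + 1::nat} = x \<otimes>\<^bsub>A \<propto> E\<^esub> x"
    and "finprod (A \<propto> E) (\<lambda>_. x) {1..1::nat} = x"
    using x(1) by (simp_all add: R.finprod_const numeral_2_eq_2 del: trivial_ext_simps)
  moreover have "(\<lambda>_. x) \<in> {1..1 + 1::nat} \<rightarrow> carrier (A \<propto> E) - Units (A \<propto> E)"
    using x(1) nonunit by blast
  ultimately show "\<not> n_OA_ideal 1 {\<zero>\<^bsub>A \<propto> E\<^esub>} (A \<propto> E)"
    unfolding n_OA_ideal_def using xx x(2) by (metis singletonD singletonI)
qed

end

theory Submission
  imports "HOL-Algebra.Ring_Divisibility" Defs
begin

text \<open>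
  Let \<open>N = 0 \<times> E\<close>. It is an ideal of \<open>R = A \<propto> E\<close> with \<open>N\<^sup>2 = 0\<close> and quotient \<open>A\<close>, so it is prime, and
  it is maximal exactly when \<open>A\<close> is a field.

  If \<open>A\<close> is a field, then every nonunit lies in \<open>N\<close>, hence a product of two or more nonunits is
  zero and, for \<open>n \<ge> 2\<close>, every proper ideal is \<open>n\<close>-OA
  (\<open>n_OA_ideal_if_nonunits_square_zero\<close>). If every proper ideal is
  \<open>n\<close>-OA, each one is a product with a single factor.

  The substance is that an \<open>n\<close>-OAF-ring \<open>R\<close> forces \<open>N\<close> to be maximal (\<open>square_zero_prime_maximal\<close>).
  Suppose it is not. Choose \<open>0 \<noteq> z \<in> N\<close> and a maximal ideal \<open>M\<close> containing the annihilator of \<open>z\<close>;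
  then \<open>N \<subset> M\<close>, and some \<open>x \<in> M\<close> lies outside \<open>N\<close>. Two factorizations contradict each other.

  The first is that of the principal ideal \<open>zR\<close>. One factor lies in the prime \<open>N\<close>, and an \<open>n\<close>-OA
  ideal inside \<open>N\<close> can only be \<open>N\<close> itself (\<open>n_OA_ideal_in_square_zero_prime\<close>), so \<open>zR = NK\<close>. If
  \<open>NM = N\<close>, then \<open>zR = M(zR)\<close>, so \<open>z = mz\<close> with \<open>m \<in> M\<close>, and \<open>1 - m\<close> annihilates \<open>z\<close> and lies in
  \<open>M\<close>, which is absurd. Therefore \<open>NM \<noteq> N\<close>.

  The second is that of \<open>I = x\<^bsup>n+1\<^esup>R + N\<close>. Some factor \<open>J\<close> lies in \<open>M\<close>; write \<open>I = JL\<close>. If \<open>L \<subseteq> M\<close> as well,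
  then \<open>N \<subseteq> M\<^sup>2\<close>, and in a trivial extension this gives \<open>N = NM\<close> (\<open>trivial_ext_split\<close>). So there is
  \<open>b \<in> L\<close> outside \<open>M\<close>. As \<open>x\<^bsup>n+1\<^esup> \<in> J\<close> and \<open>J\<close> is \<open>n\<close>-OA, also \<open>x\<^sup>n \<in> J\<close>, hence \<open>x\<^sup>nb \<in> I\<close>. Modulo the
  prime \<open>N\<close> one may cancel \<open>x\<^sup>n\<close>, so \<open>b\<close> is a multiple of \<open>x\<close> modulo \<open>N\<close> and lies in \<open>M\<close>:
  a contradiction.
\<close>

section \<open>Ideals, products and prime ideals\<close>

lemma (in cring) proper_ideal_subset_maximalideal:
  assumes "ideal I R" and "I \<noteq> carrier R"
  obtains M where "maximalideal M R" and "I \<subseteq> M"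
proof -
  define S where "S = {J. ideal J R \<and> I \<subseteq> J \<and> \<one> \<notin> J}"
  have "I \<in> S"
    using assms ideal.one_imp_carrier unfolding S_def by blast
  have "\<exists>M\<in>S. \<forall>X\<in>S. M \<subseteq> X \<longrightarrow> X = M"
  proof (rule subset_Zorn_nonempty)
    show "S \<noteq> {}" using \<open>I \<in> S\<close> by blast
    fix C assume C: "C \<noteq> {}" "subset.chain S C"
    then have "C \<subseteq> S" by (simp add: subset.chain_def)
    have "subset.chain {J. ideal J R} C"
      using C(2) unfolding subset.chain_def S_def by blast
    then have "ideal (\<Union>C) R"
      using chain_Union_is_ideal[of C] C(1) by simp
    then show "\<Union>C \<in> S"
      using \<open>C \<subseteq> S\<close> C(1) unfolding S_def by blast
  qed
  then obtain M where M: "M \<in> S" and max: "\<And>X. X \<in> S \<Longrightarrow> M \<subseteq> X \<Longrightarrow> X = M"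
    by blast
  have "maximalideal M R"
  proof (rule maximalidealI)
    show "ideal M R" and "carrier R \<noteq> M"
      using M by (auto simp: S_def)
    fix J assume J: "ideal J R" "M \<subseteq> J" "J \<subseteq> carrier R"
    show "J = M \<or> J = carrier R"
    proof (cases "\<one> \<in> J")
      case True
      then show ?thesis using J(1) ideal.one_imp_carrier by blast
    next
      case False
      then show ?thesis using J M max[of J] unfolding S_def by blast
    qed
  qed
  then show thesis using M that unfolding S_def by blast
qed

lemma (in cring) proper_ideal_nonunit:
  assumes "ideal I R" and "I \<noteq> carrier R" and "x \<in> I"
  shows "x \<in> carrier R - Units R"
  using assms by (metis DiffI ideal.I_l_closed ideal.Icarr ideal.one_imp_carrier Units_l_inv_ex)

lemma (in cring) primeideal_pow_notin:
  assumes "primeideal P R" and "x \<in> carrier R" and "x \<notin> P"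
  shows "x [^] (k::nat) \<notin> P"
proof -
  interpret P: primeideal P R by fact
  show ?thesis
  proof (induction k)
    case 0
    then show ?case using P.one_imp_carrier P.I_notcarr by auto
  next
    case (Suc k)
    then show ?case using P.I_prime[of "x [^] k" x] assms by auto
  qed
qed

text \<open>With \<open>z \<in> M \<cdot> (PIdl z)\<close> this produces the relation \<open>z = m \<otimes> z\<close> of Nakayama's argument.\<close>

lemma (in cring) ideal_prod_PIdl:
  assumes "ideal I R" and "z \<in> carrier R" and "t \<in> I \<cdot> (PIdl z)"
  shows "\<exists>m\<in>I. t = m \<otimes> z"
  using assms(3)
proof induction
  case (prod i j)
  then obtain r where r: "r \<in> carrier R" "j = r \<otimes> z"
    by (auto simp: cgenideal_def)
  then have "i \<otimes> j = (i \<otimes> r) \<otimes> z"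
    using prod assms ideal.Icarr by (metis m_assoc)
  then show ?case
    using prod r assms(1) ideal.I_r_closed by metis
next
  case (sum s1 s2)
  then obtain m1 m2 where "m1 \<in> I" "m2 \<in> I" "s1 = m1 \<otimes> z" "s2 = m2 \<otimes> z"
    by blast
  then show ?case
    using assms ideal.Icarr[OF assms(1)] additive_subgroup.a_closed[OF ideal.axioms(1)[OF assms(1)]]
    by (intro bexI[of _ "m1 \<oplus> m2"]) (auto simp: l_distr)
qed

lemma (in cring) ideal_ideal_product:
  assumes "\<forall>J\<in>set Is. ideal J R"
  shows "ideal (ideal_product R Is) R"
  using assms by (induction Is) (auto simp: ideal_product_def oneideal ideal_prod_is_ideal)

text \<open>Primality selects a factor inside \<open>P\<close>; commutativity then moves it to the front, so that the
  remaining factors can be handled as a single ideal \<open>K\<close>.\<close>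

lemma (in cring) ideal_product_subset_primeideal:
  assumes "\<forall>J\<in>set Is. ideal J R" and "primeideal P R" and "ideal_product R Is \<subseteq> P"
  shows "\<exists>J\<in>set Is. J \<subseteq> P \<and> (\<exists>K. ideal K R \<and> ideal_product R Is = J \<cdot> K)"
  using assms(1,3)
proof (induction Is)
  case Nil
  have "P \<subseteq> carrier R"
    using assms(2) by (meson ideal.Icarr primeideal.axioms(1) subsetI)
  then show ?case
    using Nil primeideal.I_notcarr[OF assms(2)] by (auto simp: ideal_product_def)
next
  case (Cons I Is)
  have eq: "ideal_product R (I # Is) = I \<cdot> ideal_product R Is"
    by (simp add: ideal_product_def)
  have I: "ideal I R" and Is: "ideal (ideal_product R Is) R"
    using Cons.prems ideal_ideal_product[of Is] by auto
  show ?case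
  proof (cases "I \<subseteq> P")
    case True
    then show ?thesis using eq Is by auto
  next
    case False
    then have "ideal_product R Is \<subseteq> P"
      using primeideal_divides_ideal_prod[OF assms(2) I Is] Cons.prems eq by simp
    then obtain J K where J: "J \<in> set Is" "J \<subseteq> P" "ideal K R" "ideal_product R Is = J \<cdot> K"
      using Cons by auto
    have J': "ideal J R" using J Cons.prems by auto
    have "I \<cdot> (J \<cdot> K) = J \<cdot> (I \<cdot> K)"
      using I J J' ideal_prod_assoc ideal_prod_commute by metis
    then show ?thesis
      using J I eq ideal_prod_is_ideal by (metis list.set_intros(2))
  qed
qed

section \<open>Absorbing ideals\<close>

text \<open>The defining condition is only ever applied to sequences \<open>x, \<dots>, x, y, z\<close> of length \<open>n + 1\<close>.\<close>

lemma (in cring) n_OA_ideal_absorbs: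
  assumes "n_OA_ideal n I R" and "n \<ge> 1"
    and "x \<in> carrier R - Units R" and "y \<in> carrier R - Units R" and "z \<in> carrier R - Units R"
    and "x [^] (n - 1) \<otimes> y \<otimes> z \<in> I"
  shows "x [^] (n - 1) \<otimes> y \<in> I \<or> z \<in> I"
proof -
  define a where "a i = (if i = n + 1 then z else if i = n then y else x)" for i
  have a: "a \<in> {1..n + 1} \<rightarrow> carrier R - Units R"
    using assms by (auto simp: a_def)
  have sets: "{1..n + 1} = insert (n + 1) {1..n}" "{1..n} = insert n {1..n - 1}"
    using assms(2) by auto
  have "finprod R a {1..n - 1} = finprod R (\<lambda>_. x) {1..n - 1}"
    using assms by (intro finprod_cong') (auto simp: a_def)
  then have "finprod R a {1..n - 1} = x [^] (n - 1)"
    using assms by (simp add: finprod_const)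
  then have n: "finprod R a {1..n} = x [^] (n - 1) \<otimes> y"
    unfolding sets(2) using assms a
    by (subst finprod_insert) (auto simp: a_def m_comm)
  then have "finprod R a {1..n + 1} = x [^] (n - 1) \<otimes> y \<otimes> z"
    unfolding sets(1) using assms a
    by (subst finprod_insert) (auto simp: a_def m_comm)
  then have "finprod R a {1..n} \<in> I \<or> a (n + 1) \<in> I"
    using assms(1,6) a unfolding n_OA_ideal_def by metis
  then show ?thesis using n by (simp add: a_def)
qed

lemma (in cring) n_OAF_ring_if_all_n_OA:
  assumes "\<forall>I. proper_ideal I R \<longrightarrow> n_OA_ideal n I R"
  shows "n_OAF_ring n R"
  unfolding n_OAF_ring_def
proof (intro allI impI)
  fix I assume I: "proper_ideal I R"
  then have "I = ideal_product R [I]"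
    by (simp add: ideal_product_def proper_ideal_def ideal_prod_one)
  then show "\<exists>Is. (\<forall>J\<in>set Is. n_OA_ideal n J R) \<and> I = ideal_product R Is"
    using assms I by (intro exI[of _ "[I]"]) simp
qed

lemma (in cring) n_OA_ideal_if_nonunits_square_zero:
  assumes "\<And>x y. x \<in> carrier R - Units R \<Longrightarrow> y \<in> carrier R - Units R \<Longrightarrow> x \<otimes> y = \<zero>"
    and "n \<ge> 2" and "proper_ideal I R"
  shows "n_OA_ideal n I R"
  unfolding n_OA_ideal_def
proof (intro conjI ballI impI)
  fix a :: "nat \<Rightarrow> 'a" assume a: "a \<in> {1..n + 1} \<rightarrow> carrier R - Units R"
  have set: "{1..n} = insert 1 (insert 2 {3..n})" using assms(2) by auto
  have in_carr: "a 1 \<in> carrier R - Units R" "a 2 \<in> carrier R - Units R" "a \<in> {3..n} \<rightarrow> carrier R"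
    using a assms(2) by (auto simp: Pi_def)
  have "finprod R a {1..n} = a 1 \<otimes> (a 2 \<otimes> finprod R a {3..n})"
    unfolding set using in_carr by simp
  also have "\<dots> = (a 1 \<otimes> a 2) \<otimes> finprod R a {3..n}"
    using in_carr by (intro m_assoc[symmetric]) auto
  also have "\<dots> = \<zero>"
    using in_carr assms(1)[of "a 1" "a 2"] by simp
  finally show "finprod R a {1..n} \<in> I \<or> a (n + 1) \<in> I"
    using assms(3) additive_subgroup.zero_closed ideal.axioms(1)
    unfolding proper_ideal_def by metis
qed (rule assms(3))

section \<open>Square-zero primes in factorization rings\<close>

text \<open>If some \<open>w \<in> N\<close> were outside \<open>J\<close>, then \<open>x\<^bsup>n-1\<^esup>ww = 0 \<in> J\<close> would give \<open>x\<^bsup>n-1\<^esup>w \<in> J\<close>, hence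
  \<open>x\<^bsup>n-1\<^esup>xw \<in> J\<close>, and the \<open>n\<close>-OA property, now used with the last factor \<open>w\<close> again, would put a power of
  \<open>x\<close> into \<open>J \<subseteq> N\<close>.\<close>

lemma (in cring) n_OA_ideal_in_square_zero_prime:
  assumes "primeideal N R" and sq0: "\<And>u v. u \<in> N \<Longrightarrow> v \<in> N \<Longrightarrow> u \<otimes> v = \<zero>"
    and x: "x \<in> carrier R - Units R" "x \<notin> N"
    and "n_OA_ideal n J R" and "n \<ge> 1" and "J \<subseteq> N"
  shows "J = N"
proof (rule ccontr)
  assume "J \<noteq> N"
  interpret N: primeideal N R by fact
  interpret J: ideal J R using assms(5) by (simp add: n_OA_ideal_def proper_ideal_def)
  obtain w where w: "w \<in> N" "w \<notin> J" using \<open>J \<noteq> N\<close> \<open>J \<subseteq> N\<close> by blast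
  have wn: "w \<in> carrier R - Units R"
    using proper_ideal_nonunit[OF N.is_ideal _ w(1)] N.I_notcarr by blast
  have "x [^] (n - 1) \<otimes> w \<otimes> w = \<zero>"
    using x wn w sq0 by (simp add: m_assoc)
  then have "x [^] (n - 1) \<otimes> w \<in> J"
    using n_OA_ideal_absorbs[OF assms(5,6) x(1) wn wn] w(2) J.zero_closed by auto
  then have "x \<otimes> (x [^] (n - 1) \<otimes> w) \<in> J"
    using J.I_l_closed x by blast
  moreover have "x \<otimes> (x [^] (n - 1) \<otimes> w) = x [^] (n - 1) \<otimes> x \<otimes> w"
    using x wn by (simp add: m_ac)
  ultimately have "x [^] (n - 1) \<otimes> x \<in> J"
    using n_OA_ideal_absorbs[OF assms(5,6) x(1) x(1) wn] w(2) by auto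
  then have "x [^] (n - 1) \<otimes> x \<in> N" using \<open>J \<subseteq> N\<close> by blast
  then show False
    using primeideal_pow_notin[OF assms(1), of x "Suc (n - 1)"] x by simp
qed

text \<open>The inclusion \<open>N \<inter> M\<^sup>2 \<subseteq> NM\<close> stands in for the splitting of \<open>R \<rightarrow> R/N\<close>: it is
  the one feature of a trivial extension, beyond \<open>N\<close> being a nonzero prime of square zero, that the
  argument depends on.\<close>

lemma (in cring) square_zero_prime_maximal:
  assumes OAF: "n_OAF_ring n R" and n: "n \<ge> 1"
    and "primeideal N R" and N0: "N \<noteq> {\<zero>}"
    and sq0: "\<And>u v. u \<in> N \<Longrightarrow> v \<in> N \<Longrightarrow> u \<otimes> v = \<zero>"
    and split: "\<And>M. ideal M R \<Longrightarrow> N \<subseteq> M \<Longrightarrow> N \<inter> (M \<cdot> M) \<subseteq> N \<cdot> M"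
  shows "maximalideal N R"
proof (rule ccontr)
  assume notmax: "\<not> maximalideal N R"
  interpret N: primeideal N R by fact
  note N = N.is_ideal
  obtain z where z: "z \<in> N" "z \<noteq> \<zero>"
    using N0 N.zero_closed by blast
  have zc: "z \<in> carrier R" using z N.Icarr by blast
  define Ann where "Ann = {r \<in> carrier R. z \<otimes> r \<in> {\<zero>}}"
  have "ideal Ann R"
    unfolding Ann_def by (rule ideal.helper_max_prime[OF zeroideal is_cring zc])
  moreover have "\<one> \<notin> Ann" using z zc by (simp add: Ann_def)
  ultimately obtain M where M': "maximalideal M R" and "Ann \<subseteq> M"
    using proper_ideal_subset_maximalideal by (metis one_closed)
  interpret M: maximalideal M R by fact
  note M = M.is_ideal
  have Mprime: "primeideal M R" using maximalideal_prime M' by blast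
  have "N \<subseteq> M"
    using sq0[OF z(1)] N.Icarr \<open>Ann \<subseteq> M\<close> by (auto simp: Ann_def)
  have "N \<noteq> M" using notmax M' by blast
  then obtain x where x: "x \<in> M" "x \<notin> N" using \<open>N \<subseteq> M\<close> by blast
  have xn: "x \<in> carrier R - Units R"
    using proper_ideal_nonunit[OF M _ x(1)] M.I_notcarr by blast
  then have xc: "x \<in> carrier R" by blast

  obtain K where K: "ideal K R" "PIdl z = N \<cdot> K"
  proof -
    have "PIdl z \<subseteq> N" using cgenideal_minimal[OF N z(1)] .
    then have "proper_ideal (PIdl z) R"
      using cgenideal_ideal[OF zc] N.I_notcarr N.Icarr unfolding proper_ideal_def by blast
    then obtain Is where Is: "\<forall>J\<in>set Is. n_OA_ideal n J R" "PIdl z = ideal_product R Is"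
      using OAF unfolding n_OAF_ring_def by blast
    then have "\<forall>J\<in>set Is. ideal J R" by (simp add: n_OA_ideal_def proper_ideal_def)
    from ideal_product_subset_primeideal[OF this \<open>primeideal N R\<close>, folded Is(2),
        OF \<open>PIdl z \<subseteq> N\<close>]
    obtain J K where "J \<in> set Is" "J \<subseteq> N" "ideal K R" "PIdl z = J \<cdot> K" by blast
    moreover from this have "J = N"
      using n_OA_ideal_in_square_zero_prime[OF \<open>primeideal N R\<close> sq0 xn x(2) _ n] Is by blast
    ultimately show thesis using that by blast
  qed

  \<comment> \<open>Nakayama's argument for \<open>zR = NK = NMK = M(zR)\<close>, with no localization because \<open>M\<close> contains
    the annihilator of \<open>z\<close>\<close>
  have NM: "N \<cdot> M \<noteq> N"
  proof
    assume eq: "N \<cdot> M = N"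
    have "PIdl z = M \<cdot> (PIdl z)"
      using eq K M N ideal_prod_assoc ideal_prod_commute by metis
    then obtain m where m: "m \<in> M" "z = m \<otimes> z"
      using ideal_prod_PIdl[OF M zc] cgenideal_self[OF zc] by metis
    then have mc: "m \<in> carrier R" using M.Icarr by blast
    have "z \<otimes> (\<one> \<ominus> m) = z \<ominus> m \<otimes> z"
      using zc mc by algebra
    also have "\<dots> = \<zero>" using m(2) zc by (simp add: r_neg minus_eq)
    finally have "\<one> \<ominus> m \<in> M"
      using \<open>Ann \<subseteq> M\<close> zc mc by (auto simp: Ann_def)
    then have "(\<one> \<ominus> m) \<oplus> m \<in> M" using m M.a_closed by blast
    moreover have "(\<one> \<ominus> m) \<oplus> m = \<one>" using mc by algebra
    ultimately show False using M.one_imp_carrier M.I_notcarr by auto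
  qed

  \<comment> \<open>The exponent \<open>n + 1\<close> is the least for which an \<open>n\<close>-OA ideal containing the power must contain a
    smaller power; the summand \<open>N\<close> turns \<open>I \<subseteq> M\<^sup>2\<close> into a statement about \<open>N\<close>.\<close>
  define I where "I = PIdl (x [^] (n + 1)) <+>\<^bsub>R\<^esub> N"
  have xpow: "x [^] (n + 1) \<in> carrier R" using xc by blast
  have mem_I: "t \<in> I \<longleftrightarrow> (\<exists>r\<in>carrier R. \<exists>u\<in>N. t = r \<otimes> x [^] (n + 1) \<oplus> u)" for t
    unfolding I_def set_add_def' cgenideal_def by blast
  have idI: "ideal I R"
    unfolding I_def using add_ideals cgenideal_ideal[OF xpow] N by blast
  have "I \<subseteq> M"
  proof
    fix t assume "t \<in> I"
    then obtain r u where ru: "r \<in> carrier R" "u \<in> N" "t = r \<otimes> x [^] (n + 1) \<oplus> u"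
      using mem_I by blast
    have "x [^] (n + 1) \<in> M"
      using x(1) xc M.I_l_closed by simp
    then show "t \<in> M" using ru \<open>N \<subseteq> M\<close> M.I_l_closed M.a_closed by blast
  qed
  have "N \<subseteq> I"
  proof
    fix u assume "u \<in> N"
    then show "u \<in> I"
      unfolding mem_I using xpow N.Icarr
      by (intro bexI[of _ \<zero>] bexI[of _ u]) (simp_all del: nat_pow_Suc)
  qed
  have xI: "x [^] (n + 1) \<in> I"
    unfolding mem_I using xpow N.zero_closed
    by (intro bexI[of _ \<one>] bexI[of _ \<zero>]) (simp_all del: nat_pow_Suc)
  have "proper_ideal I R"
    using idI \<open>I \<subseteq> M\<close> M.I_notcarr M.Icarr unfolding proper_ideal_def by blast
  then obtain Is where Is: "\<forall>J\<in>set Is. n_OA_ideal n J R" "I = ideal_product R Is"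
    using OAF unfolding n_OAF_ring_def by blast
  then have "\<forall>J\<in>set Is. ideal J R" by (simp add: n_OA_ideal_def proper_ideal_def)
  from ideal_product_subset_primeideal[OF this Mprime, folded Is(2), OF \<open>I \<subseteq> M\<close>]
  obtain J L where "J \<in> set Is" "J \<subseteq> M" and L: "ideal L R" "I = J \<cdot> L"
    by blast
  then have J: "n_OA_ideal n J R" "ideal J R" "J \<subseteq> M"
    using Is(1) by (simp_all add: n_OA_ideal_def proper_ideal_def)
  have "\<not> L \<subseteq> M"
  proof
    assume "L \<subseteq> M"
    have "J \<cdot> L \<subseteq> M \<cdot> M"
    proof
      fix t assume "t \<in> J \<cdot> L"
      then show "t \<in> M \<cdot> M"
        by induction (use J(3) \<open>L \<subseteq> M\<close> in \<open>auto intro: ideal_prod.intros\<close>)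
    qed
    then have "N \<subseteq> N \<cdot> M"
      using split[OF M \<open>N \<subseteq> M\<close>] \<open>N \<subseteq> I\<close> L(2) by blast
    then show False using NM ideal_prod_inter[OF N M] by blast
  qed
  then obtain b where b: "b \<in> L" "b \<notin> M" by blast
  have bc: "b \<in> carrier R" using b L ideal.Icarr by metis
  have "x [^] n \<in> J"
  proof -
    have pow: "x [^] n = x [^] (n - 1) \<otimes> x"
      using n by (metis Suc_diff_1 less_eq_Suc_le One_nat_def nat_pow_Suc)
    have "x [^] (n + 1) \<in> J"
      using xI L ideal_prod_inter[OF J(2) L(1)] by blast
    then have "x [^] (n - 1) \<otimes> x \<otimes> x \<in> J" using pow by simp
    then have "x [^] n \<in> J \<or> x \<in> J"
      using n_OA_ideal_absorbs[OF J(1) n xn xn xn] pow by auto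
    then show ?thesis
      using pow xc ideal.I_l_closed[OF J(2)] by auto
  qed
  then have "x [^] n \<otimes> b \<in> I" using b L ideal_prod.prod by metis
  then obtain r u where ru: "r \<in> carrier R" "u \<in> N" "x [^] n \<otimes> b = r \<otimes> x [^] (n + 1) \<oplus> u"
    using mem_I by blast
  have uc: "u \<in> carrier R" using ru N.Icarr by blast
  have pc: "x [^] n \<in> carrier R" using xc by blast
  \<comment> \<open>cancelling \<open>x\<^sup>n\<close> modulo the prime \<open>N\<close> shows that \<open>b\<close> is congruent to \<open>rx \<in> M\<close>\<close>
  have "x [^] n \<otimes> (b \<ominus> r \<otimes> x) = x [^] n \<otimes> b \<ominus> r \<otimes> x [^] (n + 1)"
    using pc xc bc ru(1) by (simp, algebra)
  also have "\<dots> = u"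
  proof -
    have "(c \<oplus> u) \<ominus> c = u" if "c \<in> carrier R" for c
      using that uc by algebra
    then show ?thesis unfolding ru(3) using xpow ru(1) by blast
  qed
  finally have *: "x [^] n \<otimes> (b \<ominus> r \<otimes> x) \<in> N" using ru(2) by simp
  have "b \<ominus> r \<otimes> x \<in> N"
    using N.I_prime[OF pc _ *] primeideal_pow_notin[OF assms(3) xc x(2)] bc ru(1) xc by auto
  then have "(b \<ominus> r \<otimes> x) \<oplus> r \<otimes> x \<in> M"
    using \<open>N \<subseteq> M\<close> x(1) ru(1) M.I_l_closed M.a_closed by blast
  moreover have "(b \<ominus> r \<otimes> x) \<oplus> r \<otimes> x = b" using bc ru(1) xc by algebra
  ultimately show False using b(2) by simp
qed

section \<open>The trivial extension\<close>

lemma (in module) ideal_trivial_ext: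
  assumes "ideal I R"
  shows "ideal (I \<times> carrier M) (R \<propto> M)"
proof -
  interpret I: ideal I R by fact
  interpret T: cring "R \<propto> M" by (rule cring_trivial_ext) (rule module_axioms)
  have "I \<noteq> {}" using I.zero_closed by blast
  have neg: "\<ominus>\<^bsub>R \<propto> M\<^esub> (a, e) = (\<ominus> a, \<ominus>\<^bsub>M\<^esub> e)" if "a \<in> carrier R" "e \<in> carrier M" for a e
    using that by (intro T.minus_equality) (auto simp: R.l_neg M.l_neg)
  show ?thesis
  proof (rule idealI)
    show "ring (R \<propto> M)" by (rule T.ring_axioms)
    show "subgroup (I \<times> carrier M) (add_monoid (R \<propto> M))"
    proof (rule T.add.subgroupI)
      fix x assume "x \<in> I \<times> carrier M"
      then show "\<ominus>\<^bsub>R \<propto> M\<^esub> x \<in> I \<times> carrier M"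
        using neg I.Icarr by auto
    qed (use I.Icarr \<open>I \<noteq> {}\<close> in auto)
  qed (use I.I_l_closed I.I_r_closed I.Icarr in auto)
qed

lemma primeideal_trivial_ext:
  assumes "domain A" and "module A E"
  shows "primeideal ({\<zero>\<^bsub>A\<^esub>} \<times> carrier E) (A \<propto> E)"
proof -
  interpret A: "domain" A by fact
  interpret E: module A E by fact
  show ?thesis
  proof (rule primeidealI)
    show "ideal ({\<zero>\<^bsub>A\<^esub>} \<times> carrier E) (A \<propto> E)"
      by (rule E.ideal_trivial_ext) (rule A.zeroideal)
    show "carrier (A \<propto> E) \<noteq> {\<zero>\<^bsub>A\<^esub>} \<times> carrier E"
      using A.one_closed A.one_not_zero E.M.zero_closed
      by (metis mem_Sigma_iff singletonD trivial_ext_simps(1))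
  qed (auto simp: cring_trivial_ext assms dest: A.integral)
qed

text \<open>The \<open>M\<close>-component of \<open>(a, e)(b, f)\<close> is that of \<open>(0, f)(a, e) + (0, e)(b, f)\<close>, an element of the
  right-hand side. So projecting any element of \<open>I\<^sup>2\<close> to \<open>0 \<times> M\<close> lands in that ideal product,
  and an element of the intersection is its own projection.\<close>

lemma (in module) trivial_ext_split:
  assumes "ideal I (R \<propto> M)"
  shows "({\<zero>} \<times> carrier M) \<inter> (I \<cdot>\<^bsub>R \<propto> M\<^esub> I) \<subseteq> ({\<zero>} \<times> carrier M) \<cdot>\<^bsub>R \<propto> M\<^esub> I"
proof -
  interpret I: ideal I "R \<propto> M" by fact
  define N where "N = {\<zero>} \<times> carrier M"
  have "(\<zero>, snd t) \<in> N \<cdot>\<^bsub>R \<propto> M\<^esub> I \<and> snd t \<in> carrier M" if "t \<in> I \<cdot>\<^bsub>R \<propto> M\<^esub> I" for t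
    using that
  proof induction
    case (prod i j)
    obtain a e b f where ij: "i = (a, e)" "j = (b, f)"
      by (metis surj_pair)
    have carr: "a \<in> carrier R" "b \<in> carrier R" "e \<in> carrier M" "f \<in> carrier M"
      using prod I.Icarr ij by auto
    have "(\<zero>, f) \<otimes>\<^bsub>R \<propto> M\<^esub> (a, e) \<in> N \<cdot>\<^bsub>R \<propto> M\<^esub> I"
      using prod ij carr by (intro ideal_prod.prod) (auto simp: N_def)
    moreover have "(\<zero>, e) \<otimes>\<^bsub>R \<propto> M\<^esub> (b, f) \<in> N \<cdot>\<^bsub>R \<propto> M\<^esub> I"
      using prod ij carr by (intro ideal_prod.prod) (auto simp: N_def)
    ultimately have "(\<zero>, f) \<otimes>\<^bsub>R \<propto> M\<^esub> (a, e) \<oplus>\<^bsub>R \<propto> M\<^esub> (\<zero>, e) \<otimes>\<^bsub>R \<propto> M\<^esub> (b, f) \<in> N \<cdot>\<^bsub>R \<propto> M\<^esub> I"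
      by (rule ideal_prod.sum)
    then show ?case using carr ij by simp
  next
    case (sum s t)
    then have "(\<zero>, snd s) \<oplus>\<^bsub>R \<propto> M\<^esub> (\<zero>, snd t) \<in> N \<cdot>\<^bsub>R \<propto> M\<^esub> I"
      by (intro ideal_prod.sum) auto
    then show ?case using sum by (cases s; cases t) simp
  qed
  then show ?thesis unfolding N_def by fastforce
qed

lemma field_if_n_OAF_trivial_ext:
  assumes "domain A" and "module A E" and "carrier E \<noteq> {\<zero>\<^bsub>E\<^esub>}"
    and "n \<ge> 1" and "n_OAF_ring n (A \<propto> E)"
  shows "field A"
proof -
  interpret A: "domain" A by fact
  interpret E: module A E by fact
  interpret R: cring "A \<propto> E" by (rule cring_trivial_ext) fact
  define N where "N = {\<zero>\<^bsub>A\<^esub>} \<times> carrier E"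
  have "N \<noteq> {\<zero>\<^bsub>A \<propto> E\<^esub>}" using assms(3) E.M.zero_closed by (auto simp: N_def)
  then have "maximalideal N (A \<propto> E)"
    using assms E.trivial_ext_split primeideal_trivial_ext
    by (intro R.square_zero_prime_maximal[of n N]) (auto simp: N_def)
  then interpret N: maximalideal N "A \<propto> E" .
  show ?thesis
  proof (rule A.zeromaximalideal_fieldI, rule maximalidealI)
    show "ideal {\<zero>\<^bsub>A\<^esub>} A" by (rule A.zeroideal)
    show "carrier A \<noteq> {\<zero>\<^bsub>A\<^esub>}" using A.one_closed A.one_not_zero by blast
    fix J assume J: "ideal J A" "{\<zero>\<^bsub>A\<^esub>} \<subseteq> J" "J \<subseteq> carrier A"
    then have "J \<times> carrier E = N \<or> J \<times> carrier E = carrier (A \<propto> E)"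
      by (intro N.I_maximal E.ideal_trivial_ext) (auto simp: N_def)
    then show "J = {\<zero>\<^bsub>A\<^esub>} \<or> J = carrier A"
      using E.M.zero_closed by (auto simp: N_def times_eq_iff)
  qed
qed

text \<open>An element \<open>(a, e)\<close> with \<open>a\<close> invertible has the inverse \<open>(a\<^bsup>-1\<^esup>, -a\<^bsup>-2\<^esup>e)\<close>.\<close>

lemma nonunit_trivial_ext_field:
  assumes "field A" and "module A E" and "x \<in> carrier (A \<propto> E) - Units (A \<propto> E)"
  shows "x \<in> {\<zero>\<^bsub>A\<^esub>} \<times> carrier E"
proof (rule ccontr)
  interpret A: field A by fact
  interpret E: module A E by fact
  interpret R: cring "A \<propto> E" by (rule cring_trivial_ext) fact
  assume "x \<notin> {\<zero>\<^bsub>A\<^esub>} \<times> carrier E"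
  with assms(3) obtain a e where x: "x = (a, e)" "a \<in> carrier A" "a \<noteq> \<zero>\<^bsub>A\<^esub>" "e \<in> carrier E"
    by auto
  then have "a \<in> Units A" using A.field_Units by blast
  then obtain c where c: "c \<in> carrier A" "a \<otimes>\<^bsub>A\<^esub> c = \<one>\<^bsub>A\<^esub>"
    using A.Units_r_inv_ex by blast
  define y where "y = (c, \<ominus>\<^bsub>E\<^esub> (c \<odot>\<^bsub>E\<^esub> (c \<odot>\<^bsub>E\<^esub> e)))"
  have y: "y \<in> carrier (A \<propto> E)" using x c by (simp add: y_def)
  have "a \<odot>\<^bsub>E\<^esub> (c \<odot>\<^bsub>E\<^esub> (c \<odot>\<^bsub>E\<^esub> e)) = c \<odot>\<^bsub>E\<^esub> e"
    using x c by (simp add: E.smult_assoc1[symmetric] A.m_assoc[symmetric])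
  then have "x \<otimes>\<^bsub>A \<propto> E\<^esub> y = \<one>\<^bsub>A \<propto> E\<^esub>"
    using x c by (simp add: y_def E.smult_r_minus E.M.l_neg)
  moreover from this have "y \<otimes>\<^bsub>A \<propto> E\<^esub> x = \<one>\<^bsub>A \<propto> E\<^esub>"
    using y assms(3) R.m_comm by (metis DiffD1)
  ultimately show False using y assms(3) unfolding Units_def by blast
qed

lemma all_n_OA_if_field:
  assumes "field A" and "module A E" and "n \<ge> 2" and "proper_ideal I (A \<propto> E)"
  shows "n_OA_ideal n I (A \<propto> E)"
proof -
  interpret E: module A E by fact
  interpret R: cring "A \<propto> E" by (rule cring_trivial_ext) fact
  have "x \<otimes>\<^bsub>A \<propto> E\<^esub> y = \<zero>\<^bsub>A \<propto> E\<^esub>"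
    if "x \<in> carrier (A \<propto> E) - Units (A \<propto> E)" "y \<in> carrier (A \<propto> E) - Units (A \<propto> E)" for x y
    using that[THEN nonunit_trivial_ext_field[OF assms(1,2)]] by auto
  then show ?thesis
    using assms R.n_OA_ideal_if_nonunits_square_zero by blast
qed

theorem corollary4p6:
  fixes A :: "('a, 'm) ring_scheme" and E :: "('a, 'e, 'k) module_scheme" and n :: nat
  assumes "domain A"
    and "module A E" and "carrier E \<noteq> {\<zero>\<^bsub>E\<^esub>}"
    and "R = A \<propto> E"
    and "n \<ge> 1"
  shows "(n \<ge> 2 \<longrightarrow>
            (n_OAF_ring n R \<longleftrightarrow> field A) \<and>
            (field A \<longleftrightarrow> (\<forall>I. proper_ideal I R \<longrightarrow> n_OA_ideal n I R))) \<and>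
         (n_OAF_ring n R \<longrightarrow> field A) \<and>
         ((\<forall>I. proper_ideal I R \<longrightarrow> n_OA_ideal n I R) \<longrightarrow> n_OAF_ring n R)"
proof -
  interpret R: cring R
    unfolding assms(4) by (rule cring_trivial_ext) fact
  have "n_OAF_ring n R \<Longrightarrow> field A"
    using field_if_n_OAF_trivial_ext assms by blast
  moreover have "n \<ge> 2 \<Longrightarrow> field A \<Longrightarrow> \<forall>I. proper_ideal I R \<longrightarrow> n_OA_ideal n I R"
    using all_n_OA_if_field assms by blast
  moreover have "\<forall>I. proper_ideal I R \<longrightarrow> n_OA_ideal n I R \<Longrightarrow> n_OAF_ring n R"
    by (rule R.n_OAF_ring_if_all_n_OA)
  ultimately show ?thesis by blast
qed

end
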